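(* Let $\mathcal{A}$ be a sixth order three dimensional truncated Hankel tensor, with generating vector $\mathbf{v} = (v_0, 0,0,0,0,0, v_6, 0,0,0,0,0, v_{12})^\top \in \mathbb{R}^{13}$. The following statements are equivalent: (i) $\mathcal{A}$ is a PSD Hankel tensor; (ii) $\mathcal{A}$ is an SOS Hankel tensor; (iii) $v_0 \ge 0$, $v_6 \ge 0$, $v_{12} \ge 0$ and $$\sqrt{v_0 v_{12}} \ge (560 + 70\sqrt{70})\, v_6.$$ Furthermore, $\mathcal{A}$ is positive definite if and only if $v_0, v_6, v_{12} > 0$ and $\sqrt{v_0 v_{12}} > (560 + 70\sqrt{70})\, v_6$.
   Context: The sixth order three dimensional Hankel tensor with generating vector $\mathbf{v}=(v_0,\ldots,v_{12})^\top$ is the real symmetric tensor $\mathcal{A}=(a_{i_1\cdots i_6})$ with $a_{i_1\cdots i_6}=v_{i_1+\cdots+i_6-6}$ for $i_1,\ldots,i_6\in\{1,2,3\}$; it is called truncated if all entries of $\mathbf{v}$ other than $v_0,v_6,v_{12}$ are zero. Let $f(\mathbf{x})=\sum_{i_1,\ldots,i_6=1}^3 a_{i_1\cdots i_6}x_{i_1}\cdots x_{i_6}$. The tensor $\mathcal{A}$ is PSD (positive semi-definite) if $f(\mathbf{x})\ge 0$ for all $\mathbf{x}\in\mathbb{R}^3$, positive definite if $f(\mathbf{x})>0$ for all $\mathbf{x}\in\mathbb{R}^3\setminus\{\mathbf{0}\}$, and SOS if $f$ is a finite sum of squares of real homogeneous polynomials of degree $3$. *)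

theory Defs
  imports "HOL-Analysis.Analysis"
begin

text \<open>
  Indices of \<open>real ^ 3\<close> range over the type \<open>3\<close>, whose numerals \<open>1\<close>, \<open>2\<close>, \<open>3\<close> are taken modulo 3
  (so \<open>3 = 0\<close>). The map below recovers the number in \<open>{1, 2, 3}\<close> that an index stands for.
\<close>

definition idx :: "3 \<Rightarrow> nat" where
  "idx i = (if i = 1 then 1 else if i = 2 then 2 else 3)"

type_synonym tensor = "real ^ 3 ^ 3 ^ 3 ^ 3 ^ 3 ^ 3"

text \<open>
  The generating vector lives in \<open>real ^ 13\<close>; the elements \<open>0, \<dots>, 12\<close> of the index type \<open>13\<close> are
  pairwise distinct, so its components are literally \<open>v $ 0, \<dots>, v $ 12\<close>. The argument of \<open>of_nat\<close>
  below lies between 0 and 12, so neither the subtraction nor the coercion loses information.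
\<close>

definition hankel_tensor :: "real ^ 13 \<Rightarrow> tensor" where
  "hankel_tensor v =
     (\<chi> i1 i2 i3 i4 i5 i6. v $ of_nat (idx i1 + idx i2 + idx i3 + idx i4 + idx i5 + idx i6 - 6))"

definition truncated :: "real ^ 13 \<Rightarrow> bool" where
  "truncated v \<longleftrightarrow> (\<forall>k. k \<notin> {0, 6, 12} \<longrightarrow> v $ k = 0)"

definition tensor_form :: "tensor \<Rightarrow> real ^ 3 \<Rightarrow> real" where
  "tensor_form A x =
     (\<Sum>i1\<in>UNIV. \<Sum>i2\<in>UNIV. \<Sum>i3\<in>UNIV. \<Sum>i4\<in>UNIV. \<Sum>i5\<in>UNIV. \<Sum>i6\<in>UNIV.
        A $ i1 $ i2 $ i3 $ i4 $ i5 $ i6 * x $ i1 * x $ i2 * x $ i3 * x $ i4 * x $ i5 * x $ i6)"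

definition tensor_psd :: "tensor \<Rightarrow> bool" where
  "tensor_psd A \<longleftrightarrow> (\<forall>x. tensor_form A x \<ge> 0)"

definition tensor_pd :: "tensor \<Rightarrow> bool" where
  "tensor_pd A \<longleftrightarrow> (\<forall>x. x \<noteq> 0 \<longrightarrow> tensor_form A x > 0)"

text \<open>
  Real polynomials are identified with the functions they induce, which is harmless over an infinite
  field. A homogeneous polynomial of degree \<open>d\<close> is a linear combination of the monomials whose
  exponents \<open>\<alpha>\<close> add up to \<open>d\<close>; as the lemma shows, the sum has finitely many terms.
\<close>

definition homogeneous_poly :: "nat \<Rightarrow> (real ^ 'n \<Rightarrow> real) \<Rightarrow> bool" where
  "homogeneous_poly d p \<longleftrightarrow>
     (\<exists>c :: ('n \<Rightarrow> nat) \<Rightarrow> real. \<forall>x.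
        p x = (\<Sum>\<alpha> \<in> {\<alpha>. (\<Sum>i\<in>UNIV. \<alpha> i) = d}. c \<alpha> * (\<Prod>i\<in>UNIV. x $ i ^ \<alpha> i)))"

lemma finite_exponents: "finite {\<alpha> :: 'n::finite \<Rightarrow> nat. (\<Sum>i\<in>UNIV. \<alpha> i) = d}"
proof (rule finite_subset)
  show "{\<alpha> :: 'n \<Rightarrow> nat. (\<Sum>i\<in>UNIV. \<alpha> i) = d} \<subseteq> PiE UNIV (\<lambda>_. {..d})"
    by (auto simp: PiE_def intro: member_le_sum)
  show "finite (PiE (UNIV :: 'n set) (\<lambda>_. {..d}))"
    by (intro finite_PiE) auto
qed

definition tensor_sos :: "tensor \<Rightarrow> bool" where
  "tensor_sos A \<longleftrightarrow>
     (\<exists>(r :: nat) (q :: nat \<Rightarrow> real ^ 3 \<Rightarrow> real).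
        (\<forall>j<r. homogeneous_poly 3 (q j)) \<and> (\<forall>x. tensor_form A x = (\<Sum>j<r. (q j x)\<^sup>2)))"

end

theory Submission
  imports Defs
begin

text \<open>
  Collecting equal monomials, the form of the truncated Hankel tensor is
  \<open>p x\<^sup>6 + b (y\<^sup>6 + 30 x z y\<^sup>4 + 90 x\<^sup>2 z\<^sup>2 y\<^sup>2 + 20 x\<^sup>3 z\<^sup>3) + q z\<^sup>6\<close> with \<open>p, b, q\<close> the entries
  \<open>v\<^sub>0, v\<^sub>6, v\<^sub>1\<^sub>2\<close>. The middle part depends on \<open>x, z\<close> only through \<open>x z\<close>, so for \<open>p, q > 0\<close> the
  substitution \<open>x \<mapsto> \<alpha> x\<close>, \<open>z \<mapsto> z / \<alpha>\<close> makes both outer coefficients equal to \<open>s = sqrt (p q)\<close>.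
  By the inequality of the means the form is then worst where \<open>z = -x\<close>; at \<open>(1, y, -1)\<close> it equals
  \<open>2 s + b (u\<^sup>3 - 30 u\<^sup>2 + 90 u - 20)\<close> with \<open>u = y\<^sup>2\<close>. The cubic in \<open>u\<close> has its
  minimum over \<open>u \<ge> 0\<close> at \<open>u = 10 + sqrt 70\<close>, with value \<open>-2 (560 + 70 sqrt 70)\<close>. This explains the
  constant and proves the necessity of the inequality for \<open>p, q > 0\<close>; the case
  \<open>p = 0\<close> or \<open>q = 0\<close> follows by adding a small multiple of \<open>x\<^sup>6 + z\<^sup>6\<close>.

  For sufficiency, put \<open>x = a + w\<close> and \<open>z = a - w\<close>. The symmetric form becomes even in each of
  \<open>a, w, y\<close>, that is, a cubic in \<open>a\<^sup>2, w\<^sup>2, y\<^sup>2\<close>. At the critical value of \<open>s\<close> its restriction to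
  \<open>a = 0\<close> has the double root \<open>y\<^sup>2 = (10 + sqrt 70) w\<^sup>2\<close> and is thus a sum of two squares, while
  all the terms divisible by \<open>a\<^sup>2\<close> can be written as squares with positive weights
  (lemma \<open>symmetric_sextic_decomposition\<close>). What remains for larger \<open>s\<close> is a nonnegative multiple
  of \<open>x\<^sup>6 + z\<^sup>6\<close>. The same identity gives positive definiteness when the inequality is strict.
\<close>

section \<open>Closure properties of homogeneous polynomials\<close>

lemma homogeneous_poly_monomial:
  fixes \<alpha> :: "'n::finite \<Rightarrow> nat"
  assumes "(\<Sum>i\<in>UNIV. \<alpha> i) = d"
  shows "homogeneous_poly d (\<lambda>x. \<Prod>i\<in>UNIV. x $ i ^ \<alpha> i)"
  unfolding homogeneous_poly_def
proof (intro exI[of _ "\<lambda>\<beta>. if \<beta> = \<alpha> then 1 else 0"] allI)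
  fix x :: "real ^ 'n"
  show "(\<Prod>i\<in>UNIV. x $ i ^ \<alpha> i) =
      (\<Sum>\<beta>\<in>{\<beta>. (\<Sum>i\<in>UNIV. \<beta> i) = d}. (if \<beta> = \<alpha> then 1 else 0) * (\<Prod>i\<in>UNIV. x $ i ^ \<beta> i))"
    using assms by (simp add: if_distrib[of "\<lambda>t. t * _"] sum.delta' finite_exponents cong: if_cong)
qed

lemma homogeneous_poly_scale:
  fixes f :: "real ^ 'n::finite \<Rightarrow> real"
  assumes "homogeneous_poly d f"
  shows "homogeneous_poly d (\<lambda>x. c * f x)"
proof -
  obtain e where "\<And>x. f x = (\<Sum>\<alpha>\<in>{\<alpha>. (\<Sum>i\<in>UNIV. \<alpha> i) = d}. e \<alpha> * (\<Prod>i\<in>UNIV. x $ i ^ \<alpha> i))"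
    using assms unfolding homogeneous_poly_def by blast
  then show ?thesis
    unfolding homogeneous_poly_def
    by (intro exI[of _ "\<lambda>\<alpha>. c * e \<alpha>"]) (simp add: sum_distrib_left mult.assoc)
qed

lemma homogeneous_poly_add:
  fixes f g :: "real ^ 'n::finite \<Rightarrow> real"
  assumes "homogeneous_poly d f" "homogeneous_poly d g"
  shows "homogeneous_poly d (\<lambda>x. f x + g x)"
proof -
  obtain e h where
    "\<And>x. f x = (\<Sum>\<alpha>\<in>{\<alpha>. (\<Sum>i\<in>UNIV. \<alpha> i) = d}. e \<alpha> * (\<Prod>i\<in>UNIV. x $ i ^ \<alpha> i))"
    "\<And>x. g x = (\<Sum>\<alpha>\<in>{\<alpha>. (\<Sum>i\<in>UNIV. \<alpha> i) = d}. h \<alpha> * (\<Prod>i\<in>UNIV. x $ i ^ \<alpha> i))"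
    using assms unfolding homogeneous_poly_def by blast
  then show ?thesis
    unfolding homogeneous_poly_def
    by (intro exI[of _ "\<lambda>\<alpha>. e \<alpha> + h \<alpha>"]) (simp add: sum.distrib distrib_right)
qed

lemma homogeneous_poly_diff:
  fixes f g :: "real ^ 'n::finite \<Rightarrow> real"
  assumes "homogeneous_poly d f" "homogeneous_poly d g"
  shows "homogeneous_poly d (\<lambda>x. f x - g x)"
  using homogeneous_poly_add[OF assms(1) homogeneous_poly_scale[OF assms(2), of "-1"]] by simp

lemma homogeneous_poly_sum:
  fixes f :: "'b \<Rightarrow> real ^ 'n::finite \<Rightarrow> real"
  assumes "\<And>j. j \<in> S \<Longrightarrow> homogeneous_poly d (f j)"
  shows "homogeneous_poly d (\<lambda>x. \<Sum>j\<in>S. f j x)"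
proof -
  have zero: "homogeneous_poly d (\<lambda>x :: real ^ 'n. 0)"
    unfolding homogeneous_poly_def by (intro exI[of _ "\<lambda>_. 0"]) simp
  show ?thesis
    using assms
    by (induction S rule: infinite_finite_induct) (simp_all add: zero homogeneous_poly_add)
qed

lemma homogeneous_poly_mult:
  fixes f g :: "real ^ 'n::finite \<Rightarrow> real"
  assumes "homogeneous_poly d f" "homogeneous_poly e g" "n = d + e"
  shows "homogeneous_poly n (\<lambda>x. f x * g x)"
proof -
  let ?E = "\<lambda>d. {\<alpha> :: 'n \<Rightarrow> nat. (\<Sum>i\<in>UNIV. \<alpha> i) = d}"
  obtain a b where f: "\<And>x. f x = (\<Sum>\<alpha>\<in>?E d. a \<alpha> * (\<Prod>i\<in>UNIV. x $ i ^ \<alpha> i))"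
    and g: "\<And>x. g x = (\<Sum>\<beta>\<in>?E e. b \<beta> * (\<Prod>i\<in>UNIV. x $ i ^ \<beta> i))"
    using assms unfolding homogeneous_poly_def by blast
  have "homogeneous_poly n
      (\<lambda>x. \<Sum>\<alpha>\<in>?E d. \<Sum>\<beta>\<in>?E e. (a \<alpha> * b \<beta>) * (\<Prod>i\<in>UNIV. x $ i ^ (\<alpha> i + \<beta> i)))"
    using assms(3)
    by (intro homogeneous_poly_sum homogeneous_poly_scale homogeneous_poly_monomial)
       (simp add: sum.distrib)
  then show ?thesis
    by (simp add: f g sum_product power_add prod.distrib mult_ac)
qed

lemma homogeneous_poly_const: "homogeneous_poly 0 (\<lambda>x :: real ^ 'n::finite. c)"
  using homogeneous_poly_scale[OF homogeneous_poly_monomial[of "\<lambda>_ :: 'n. 0" 0], of c] by simp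

lemma homogeneous_poly_coordinate: "homogeneous_poly (Suc 0) (\<lambda>x :: real ^ 'n::finite. x $ k)"
proof -
  have "(\<Prod>i\<in>UNIV. x $ i ^ (if i = k then 1 else 0)) = x $ k" for x :: "real ^ 'n"
    by (simp add: if_distrib[of "\<lambda>m. _ ^ m"] prod.delta cong: if_cong)
  then show ?thesis
    using homogeneous_poly_monomial[of "\<lambda>i :: 'n. if i = k then 1 else 0" "Suc 0"] by simp
qed

lemma homogeneous_poly_power:
  fixes f :: "real ^ 'n::finite \<Rightarrow> real"
  assumes "homogeneous_poly d f" "n = m * d"
  shows "homogeneous_poly n (\<lambda>x. f x ^ m)"
  using assms(2)
proof (induction m arbitrary: n)
  case 0
  then show ?case by (simp add: homogeneous_poly_const)
next
  case (Suc m)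
  then show ?case
    using homogeneous_poly_mult[OF assms(1) Suc.IH[OF refl]] by simp
qed

text \<open>
  Nonnegative weights are absorbed into the polynomials, so that a certificate can be given as a
  list of weighted squares.
\<close>

lemma tensor_sosI:
  assumes "\<And>c f. (c, f) \<in> set cs \<Longrightarrow> c \<ge> 0 \<and> homogeneous_poly 3 f"
    and "\<And>x. tensor_form A x = (\<Sum>(c, f)\<leftarrow>cs. c * (f x)\<^sup>2)"
  shows "tensor_sos A"
  unfolding tensor_sos_def
proof (intro exI conjI allI impI)
  let ?q = "\<lambda>j x. sqrt (fst (cs ! j)) * snd (cs ! j) x"
  have nth: "fst (cs ! j) \<ge> 0 \<and> homogeneous_poly 3 (snd (cs ! j))" if "j < length cs" for j
    using assms(1)[of "fst (cs ! j)" "snd (cs ! j)"] that by simp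
  show "homogeneous_poly 3 (?q j)" if "j < length cs" for j
    using nth[OF that] by (simp add: homogeneous_poly_scale)
  show "tensor_form A x = (\<Sum>j<length cs. (?q j x)\<^sup>2)" for x
    using nth
    by (simp add: assms(2) sum_list_sum_nth atLeast0LessThan case_prod_beta power_mult_distrib)
qed

section \<open>The sextic form of a truncated Hankel tensor\<close>

definition hankel_sextic :: "real \<Rightarrow> real \<Rightarrow> real \<Rightarrow> real \<Rightarrow> real \<Rightarrow> real \<Rightarrow> real" where
  "hankel_sextic p b q x y z =
     p * x ^ 6 + b * (y ^ 6 + 30 * x * z * y ^ 4 + 90 * x ^ 2 * z ^ 2 * y ^ 2 + 20 * x ^ 3 * z ^ 3)
     + q * z ^ 6"

lemma tensor_form_truncated_hankel:
  assumes "truncated v"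
  shows "tensor_form (hankel_tensor v) x =
    hankel_sextic (v $ 0) (v $ 6) (v $ 12) (x $ 1) (x $ 2) (x $ 3)"
proof -
  define g where "g n = v $ of_nat n" for n
  have "g n = 0" if "n \<in> {1,2,3,4,5,7,8,9,10,11}" for n
    using assms that by (auto simp: g_def truncated_def)
  \<comment> \<open>The small indices are also given in successor form, the shape to which sums of the index
     values \<open>1 = Suc 0\<close> are normalised.\<close>
  then have g_zero: "g (Suc 0) = 0" "g (Suc (Suc 0)) = 0" "g (Suc (Suc (Suc 0))) = 0"
    "g (Suc (Suc (Suc (Suc 0)))) = 0" "g (Suc (Suc (Suc (Suc (Suc 0))))) = 0"
    "g 2 = 0" "g 3 = 0" "g 4 = 0" "g 5 = 0" "g 7 = 0" "g 8 = 0" "g 9 = 0" "g 10 = 0" "g 11 = 0"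
    by simp_all
  have idx_simps: "idx 1 = 1" "idx 2 = 2" "idx 3 = 3"
    by (simp_all add: idx_def)
  have form: "tensor_form (hankel_tensor v) x =
      (\<Sum>i1\<in>UNIV. \<Sum>i2\<in>UNIV. \<Sum>i3\<in>UNIV. \<Sum>i4\<in>UNIV. \<Sum>i5\<in>UNIV. \<Sum>i6\<in>UNIV.
        g (idx i1 + idx i2 + idx i3 + idx i4 + idx i5 + idx i6 - 6)
          * x $ i1 * x $ i2 * x $ i3 * x $ i4 * x $ i5 * x $ i6)"
    by (simp add: tensor_form_def hankel_tensor_def g_def)
  have "tensor_form (hankel_tensor v) x =
      hankel_sextic (g 0) (g 6) (g 12) (x $ 1) (x $ 2) (x $ 3)"
    unfolding form sum_3 idx_simps hankel_sextic_def
    by (simp add: g_zero) algebra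
  then show ?thesis
    by (simp add: g_def)
qed

text \<open>
  The balancing substitution: \<open>x z\<close> is unchanged, and \<open>\<alpha>\<^sup>6\<close> is the ratio of \<open>p\<close> to the geometric
  mean of \<open>p\<close> and \<open>q\<close>.
\<close>

lemma hankel_sextic_balance:
  assumes "p > 0" "q > 0"
  obtains \<alpha> where "\<alpha> > 0"
    "\<And>b x y z. hankel_sextic p b q x y z
        = hankel_sextic (sqrt (p * q)) b (sqrt (p * q)) (\<alpha> * x) y (z / \<alpha>)"
proof
  let ?s = "sqrt (p * q)"
  let ?\<alpha> = "root 6 (p / ?s)"
  have s: "?s > 0" "?s * ?s = p * q"
    using assms by simp_all
  show pos: "?\<alpha> > 0"
    using assms by simp
  have "?\<alpha> ^ 6 = p / ?s"
    using assms by (intro real_root_pow_pos2) auto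
  then have outer: "?s * ?\<alpha> ^ 6 = p" "?s / ?\<alpha> ^ 6 = q"
    using s assms by (simp_all add: divide_simps del: real_sqrt_mult)
  fix b x y z :: real
  have p: "?s * (?\<alpha> * x) ^ 6 = p * x ^ 6"
    by (simp only: power_mult_distrib mult.assoc[symmetric] outer(1))
  have q: "?s * (z / ?\<alpha>) ^ 6 = q * z ^ 6"
    using arg_cong[OF outer(2), of "\<lambda>t. t * z ^ 6"]
    by (simp only: power_divide times_divide_eq_right times_divide_eq_left)
  have "t ^ n * x ^ n * (z / t) ^ n = x ^ n * z ^ n" if "t > 0" for n t
    using that by (simp add: power_divide)
  note middle = this[OF pos]
  show "hankel_sextic p b q x y z = hankel_sextic ?s b ?s (?\<alpha> * x) y (z / ?\<alpha>)"
    unfolding hankel_sextic_def p q using middle[of 1] middle[of 2] middle[of 3]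
    by (simp only: power_mult_distrib mult.assoc power_one_right)
qed

section \<open>The critical constant and the sum of squares\<close>

definition critical :: real where
  "critical = 560 + 70 * sqrt 70"

lemma critical_ge: "critical \<ge> 560"
  by (simp add: critical_def)

lemma sqrt_70_ge: "sqrt 70 \<ge> 5"
  by (rule real_le_rsqrt) simp

text \<open>
  The two squares with the factor \<open>y\<^sup>2 - (10 + sqrt 70) w\<^sup>2\<close> are the value at \<open>a = 0\<close> when
  \<open>s = b K\<close>, where \<open>K\<close> is the critical constant: they come from the factorisation
  \<open>u\<^sup>3 - 30 u\<^sup>2 + 90 u + 2 K - 20 = (u - k)\<^sup>2 (u + c)\<close> with \<open>k = 10 + sqrt 70\<close>,
  \<open>c = 2 k - 30 = 2 sqrt 70 - 10\<close>, evaluated at \<open>u = y\<^sup>2 / w\<^sup>2\<close>. The remaining squares of terms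
  in \<open>a\<close> collect everything divisible by \<open>a\<^sup>2\<close>; there the only negative monomial,
  \<open>-180 a\<^sup>2 w\<^sup>2 y\<^sup>2\<close>, is absorbed by \<open>30 a\<^sup>2 (y\<^sup>2 - 3 w\<^sup>2)\<^sup>2\<close>.
\<close>

lemma symmetric_sextic_decomposition:
  fixes x y z :: real
  defines "a \<equiv> (x + z) / 2" and "w \<equiv> (x - z) / 2"
  shows "hankel_sextic s b s x y z =
      (s - b * critical) * ((x ^ 3)\<^sup>2 + (z ^ 3)\<^sup>2)
    + b * (2 * critical + 20) * (a ^ 3)\<^sup>2
    + b * (30 * critical - 60) * (a\<^sup>2 * w)\<^sup>2
    + b * 90 * (a\<^sup>2 * y)\<^sup>2
    + b * 30 * (a * (y\<^sup>2 - 3 * w\<^sup>2))\<^sup>2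
    + b * (30 * critical - 210) * (a * w\<^sup>2)\<^sup>2
    + b * (y * (y\<^sup>2 - (10 + sqrt 70) * w\<^sup>2))\<^sup>2
    + b * (2 * sqrt 70 - 10) * (w * (y\<^sup>2 - (10 + sqrt 70) * w\<^sup>2))\<^sup>2"
proof -
  have xz: "x = a + w" "z = a - w"
    by (simp_all add: a_def w_def field_simps)
  define r where "r = sqrt 70"
  \<comment> \<open>Both sides as polynomials in \<open>r\<close>: they differ by a multiple of \<open>r\<^sup>2 - 70\<close>.\<close>
  have "s * (a + w) ^ 6 + b * (y ^ 6 + 30 * (a + w) * (a - w) * y ^ 4
        + 90 * (a + w) ^ 2 * (a - w) ^ 2 * y ^ 2 + 20 * (a + w) ^ 3 * (a - w) ^ 3)
        + s * (a - w) ^ 6 =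
      (s - b * (560 + 70 * r)) * (((a + w) ^ 3)\<^sup>2 + ((a - w) ^ 3)\<^sup>2)
      + b * (2 * (560 + 70 * r) + 20) * (a ^ 3)\<^sup>2
      + b * (30 * (560 + 70 * r) - 60) * (a\<^sup>2 * w)\<^sup>2
      + b * 90 * (a\<^sup>2 * y)\<^sup>2
      + b * 30 * (a * (y\<^sup>2 - 3 * w\<^sup>2))\<^sup>2
      + b * (30 * (560 + 70 * r) - 210) * (a * w\<^sup>2)\<^sup>2
      + b * (y * (y\<^sup>2 - (10 + r) * w\<^sup>2))\<^sup>2
      + b * (2 * r - 10) * (w * (y\<^sup>2 - (10 + r) * w\<^sup>2))\<^sup>2
      + b * (r\<^sup>2 - 70) * (3 * y\<^sup>2 * w ^ 4 - (2 * r + 30) * w ^ 6)"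
    by algebra
  moreover have "r\<^sup>2 - 70 = 0"
    by (simp add: r_def)
  ultimately show ?thesis
    unfolding xz hankel_sextic_def critical_def r_def[symmetric] by simp
qed

section \<open>Positivity\<close>

text \<open>
  The point used here is the preimage of the critical point \<open>(1, sqrt (10 + sqrt 70), -1)\<close> under
  the balancing substitution.
\<close>

lemma hankel_sextic_critical_value:
  assumes "p > 0" "q > 0"
  obtains x y z where "x \<noteq> 0" "hankel_sextic p b q x y z = 2 * (sqrt (p * q) - critical * b)"
proof -
  obtain \<alpha> where \<alpha>: "\<alpha> > 0" and bal: "\<And>b x y z. hankel_sextic p b q x y z
      = hankel_sextic (sqrt (p * q)) b (sqrt (p * q)) (\<alpha> * x) y (z / \<alpha>)"
    using hankel_sextic_balance[OF assms] by metis
  have "(sqrt (10 + sqrt 70))\<^sup>2 = 10 + sqrt 70"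
    by (simp add: add_nonneg_nonneg)
  then have "hankel_sextic p b q (1 / \<alpha>) (sqrt (10 + sqrt 70)) (- \<alpha>)
      = 2 * (sqrt (p * q) - critical * b)"
    using \<alpha> unfolding bal symmetric_sextic_decomposition by simp
  then show thesis
    using that[of "1 / \<alpha>"] \<alpha> by simp
qed

lemma sqrt_ge_critical_if_hankel_sextic_nonneg:
  assumes "p \<ge> 0" "q \<ge> 0" and nonneg: "\<And>x y z. hankel_sextic p b q x y z \<ge> 0"
  shows "sqrt (p * q) \<ge> critical * b"
proof (rule tendsto_lowerbound)
  \<comment> \<open>Adding \<open>e (x\<^sup>6 + z\<^sup>6)\<close> makes the outer coefficients positive, so that the critical point exists.\<close>
  show "((\<lambda>e. sqrt ((p + e) * (q + e))) \<longlongrightarrow> sqrt (p * q)) (at_right 0)"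
    by (auto intro!: tendsto_eq_intros)
  show "\<forall>\<^sub>F e in at_right 0. critical * b \<le> sqrt ((p + e) * (q + e))"
  proof (rule eventually_at_rightI[of 0 1])
    fix e :: real
    assume "e \<in> {0<..<1}"
    then have e: "e > 0" by simp
    obtain x y z where val:
      "hankel_sextic (p + e) b (q + e) x y z = 2 * (sqrt ((p + e) * (q + e)) - critical * b)"
    proof (rule hankel_sextic_critical_value)
      show "p + e > 0" "q + e > 0"
        using e assms(1,2) by simp_all
    qed
    have "hankel_sextic (p + e) b (q + e) x y z = hankel_sextic p b q x y z + e * (x ^ 6 + z ^ 6)"
      by (simp add: hankel_sextic_def algebra_simps)
    also have "\<dots> \<ge> 0"
      using nonneg e by simp
    finally show "critical * b \<le> sqrt ((p + e) * (q + e))"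
      using val by simp
  qed simp
qed simp

text \<open>
  In the decomposition with \<open>s > b K\<close>, the term \<open>(s - b K) (x\<^sup>6 + z\<^sup>6)\<close> vanishes only for
  \<open>x = z = 0\<close>, where the form reduces to \<open>b y\<^sup>6\<close>.
\<close>

lemma hankel_sextic_pos:
  assumes "p > 0" "b > 0" "q > 0" "sqrt (p * q) > critical * b"
    and nz: "x \<noteq> 0 \<or> y \<noteq> 0 \<or> z \<noteq> 0"
  shows "hankel_sextic p b q x y z > 0"
proof (cases "x = 0 \<and> z = 0")
  case True
  then show ?thesis
    using nz assms(2) by (simp add: hankel_sextic_def)
next
  case False
  obtain \<alpha> where \<alpha>: "\<alpha> > 0" and bal: "\<And>b x y z. hankel_sextic p b q x y z
      = hankel_sextic (sqrt (p * q)) b (sqrt (p * q)) (\<alpha> * x) y (z / \<alpha>)"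
    using hankel_sextic_balance[OF assms(1,3)] by metis
  let ?c = "sqrt (p * q) - b * critical"
  have c: "?c > 0"
    using assms(4) by (simp add: mult.commute)
  have "((\<alpha> * x) ^ 3)\<^sup>2 + ((z / \<alpha>) ^ 3)\<^sup>2 > 0"
    using False \<alpha> by (simp only: sum_power2_gt_zero_iff) simp
  then have "?c * (((\<alpha> * x) ^ 3)\<^sup>2 + ((z / \<alpha>) ^ 3)\<^sup>2) > 0"
    using c by (intro mult_pos_pos)
  then show ?thesis
    unfolding bal symmetric_sextic_decomposition
    using assms(2) critical_ge sqrt_70_ge
    by (intro add_pos_nonneg mult_nonneg_nonneg) auto
qed

section \<open>The characterisations\<close>

text \<open>
  For \<open>v\<^sub>6 > 0\<close> the inequality forces \<open>v\<^sub>0\<close> and \<open>v\<^sub>1\<^sub>2\<close> to be positive, so that the form can be balanced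
  and the decomposition applies; its building blocks \<open>a\<close> and \<open>w\<close> are then linear forms in the
  original coordinates. For \<open>v\<^sub>6 = 0\<close> only the squares of the two pure cubes remain.
\<close>

lemma tensor_sos_if_sqrt_ge_critical:
  assumes tr: "truncated v" and nonneg: "v $ 0 \<ge> 0" "v $ 6 \<ge> 0" "v $ 12 \<ge> 0"
    and ge: "sqrt (v $ 0 * v $ 12) \<ge> critical * v $ 6"
  shows "tensor_sos (hankel_tensor v)"
proof (cases "v $ 6 = 0")
  case True
  show ?thesis
  proof (rule tensor_sosI[of "[(v $ 0, \<lambda>x. x $ 1 ^ 3), (v $ 12, \<lambda>x. x $ 3 ^ 3)]"])
    show "c \<ge> 0 \<and> homogeneous_poly 3 f"
      if "(c, f) \<in> set [(v $ 0, \<lambda>x :: real ^ 3. x $ 1 ^ 3), (v $ 12, \<lambda>x. x $ 3 ^ 3)]" for c f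
      using that nonneg by (auto intro!: homogeneous_poly_power homogeneous_poly_coordinate)
  qed (simp add: tensor_form_truncated_hankel[OF tr] hankel_sextic_def True flip: power_mult)
next
  case False
  define s b where "s = sqrt (v $ 0 * v $ 12)" and "b = v $ 6"
  have b: "b > 0"
    using False nonneg by (simp add: b_def)
  then have "critical * b > 0"
    using critical_ge by (intro mult_pos_pos) auto
  then have "sqrt (v $ 0 * v $ 12) > 0"
    using ge unfolding b_def by linarith
  then have "v $ 0 * v $ 12 > 0"
    by (simp only: real_sqrt_gt_0_iff)
  then have "v $ 0 > 0" "v $ 12 > 0"
    using nonneg by (auto simp: zero_less_mult_iff)
  then obtain \<alpha> where bal: "\<And>b x y z. hankel_sextic (v $ 0) b (v $ 12) x y z
      = hankel_sextic s b s (\<alpha> * x) y (z / \<alpha>)"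
    unfolding s_def using hankel_sextic_balance[of "v $ 0" "v $ 12"] by metis
  define X Z where "X x = \<alpha> * x $ 1" and "Z x = (1 / \<alpha>) * x $ 3" for x :: "real ^ 3"
  define a w where "a x = (1 / 2) * (X x + Z x)" and "w x = (1 / 2) * (X x - Z x)" for x :: "real ^ 3"
  have X: "homogeneous_poly 1 X" and Z: "homogeneous_poly 1 Z"
    unfolding X_def[abs_def] Z_def[abs_def]
    using homogeneous_poly_scale[OF homogeneous_poly_coordinate] by (simp_all only: One_nat_def)
  have a: "homogeneous_poly 1 a" and w: "homogeneous_poly 1 w"
    unfolding a_def[abs_def] w_def[abs_def]
    by (intro homogeneous_poly_scale homogeneous_poly_add homogeneous_poly_diff X Z)+
  let ?cs = "[(s - b * critical, \<lambda>x. X x ^ 3), (s - b * critical, \<lambda>x. Z x ^ 3),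
    (b * (2 * critical + 20), \<lambda>x. a x ^ 3),
    (b * (30 * critical - 60), \<lambda>x. (a x)\<^sup>2 * w x),
    (b * 90, \<lambda>x. (a x)\<^sup>2 * x $ 2),
    (b * 30, \<lambda>x. a x * ((x $ 2)\<^sup>2 - 3 * (w x)\<^sup>2)),
    (b * (30 * critical - 210), \<lambda>x. a x * (w x)\<^sup>2),
    (b, \<lambda>x. x $ 2 * ((x $ 2)\<^sup>2 - (10 + sqrt 70) * (w x)\<^sup>2)),
    (b * (2 * sqrt 70 - 10), \<lambda>x. w x * ((x $ 2)\<^sup>2 - (10 + sqrt 70) * (w x)\<^sup>2))]"
  show ?thesis
  proof (rule tensor_sosI[of ?cs])
    have y: "homogeneous_poly 1 (\<lambda>x :: real ^ 3. x $ 2)"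
      using homogeneous_poly_coordinate by simp
    have sq: "homogeneous_poly 2 (\<lambda>x. (f x)\<^sup>2)" if "homogeneous_poly 1 f" for f :: "real ^ 3 \<Rightarrow> real"
      using that by (rule homogeneous_poly_power) simp
    have cube: "homogeneous_poly 3 (\<lambda>x. f x ^ 3)" if "homogeneous_poly 1 f" for f :: "real ^ 3 \<Rightarrow> real"
      using that by (rule homogeneous_poly_power) simp
    have diff: "homogeneous_poly 2 (\<lambda>x. (x $ 2)\<^sup>2 - c * (w x)\<^sup>2)" for c
      by (intro homogeneous_poly_diff homogeneous_poly_scale sq y w)
    have square_mult_linear: "homogeneous_poly 3 (\<lambda>x. (f x)\<^sup>2 * g x)"
      if "homogeneous_poly 1 f" "homogeneous_poly 1 g" for f g :: "real ^ 3 \<Rightarrow> real"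
      using sq[OF that(1)] that(2) by (rule homogeneous_poly_mult) simp
    have linear_mult_quadratic: "homogeneous_poly 3 (\<lambda>x. f x * g x)"
      if "homogeneous_poly 1 f" "homogeneous_poly 2 g" for f g :: "real ^ 3 \<Rightarrow> real"
      using that by (rule homogeneous_poly_mult) simp
    have "homogeneous_poly 3 f" if "(c, f) \<in> set ?cs" for c f
      using that unfolding list.set insert_iff empty_iff prod.inject
      by (elim disjE conjE; simp only:)
        (intro cube square_mult_linear X Z a w y linear_mult_quadratic[OF a] linear_mult_quadratic[OF w]
          linear_mult_quadratic[OF y] diff sq)+
    moreover have "c \<ge> 0" if "(c, f) \<in> set ?cs" for c f
      using that b ge critical_ge sqrt_70_ge by (auto simp: s_def b_def mult.commute)
    ultimately show "c \<ge> 0 \<and> homogeneous_poly 3 f" if "(c, f) \<in> set ?cs" for c f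
      using that by blast
    show "tensor_form (hankel_tensor v) x = (\<Sum>(c, f)\<leftarrow>?cs. c * (f x)\<^sup>2)" for x
    proof -
      have fold: "\<alpha> * x $ 1 = X x" "x $ 3 / \<alpha> = Z x" "(X x + Z x) / 2 = a x" "(X x - Z x) / 2 = w x"
        by (simp_all add: X_def Z_def a_def w_def)
      show ?thesis
        unfolding tensor_form_truncated_hankel[OF tr] b_def[symmetric] bal
          symmetric_sextic_decomposition fold
        by (simp add: add.assoc distrib_left)
    qed
  qed
qed

lemma truncated_hankel_psd_iff:
  assumes "truncated v"
  shows "tensor_psd (hankel_tensor v) \<longleftrightarrow>
    (\<forall>x y z. hankel_sextic (v $ 0) (v $ 6) (v $ 12) x y z \<ge> 0)"
proof
  assume psd: "tensor_psd (hankel_tensor v)"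
  have "hankel_sextic (v $ 0) (v $ 6) (v $ 12) x y z \<ge> 0" for x y z
    using psd[unfolded tensor_psd_def tensor_form_truncated_hankel[OF assms],
        THEN spec[of _ "vector [x, y, z]"]]
    by simp
  then show "\<forall>x y z. hankel_sextic (v $ 0) (v $ 6) (v $ 12) x y z \<ge> 0"
    by blast
next
  assume "\<forall>x y z. hankel_sextic (v $ 0) (v $ 6) (v $ 12) x y z \<ge> 0"
  then show "tensor_psd (hankel_tensor v)"
    unfolding tensor_psd_def tensor_form_truncated_hankel[OF assms] by blast
qed

lemma truncated_hankel_pd_iff:
  assumes "truncated v"
  shows "tensor_pd (hankel_tensor v) \<longleftrightarrow> (\<forall>x y z. x \<noteq> 0 \<or> y \<noteq> 0 \<or> z \<noteq> 0 \<longrightarrow>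
    hankel_sextic (v $ 0) (v $ 6) (v $ 12) x y z > 0)"
proof -
  have nz: "u \<noteq> 0 \<longleftrightarrow> u $ 1 \<noteq> 0 \<or> u $ 2 \<noteq> 0 \<or> u $ 3 \<noteq> 0" for u :: "real ^ 3"
    by (simp add: vec_eq_iff forall_3)
  show ?thesis
  proof
    assume pd: "tensor_pd (hankel_tensor v)"
    have "hankel_sextic (v $ 0) (v $ 6) (v $ 12) x y z > 0" if "x \<noteq> 0 \<or> y \<noteq> 0 \<or> z \<noteq> 0" for x y z
      using that pd[unfolded tensor_pd_def nz tensor_form_truncated_hankel[OF assms],
          THEN spec[of _ "vector [x, y, z]"]]
      by simp
    then show "\<forall>x y z. x \<noteq> 0 \<or> y \<noteq> 0 \<or> z \<noteq> 0 \<longrightarrow>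
        hankel_sextic (v $ 0) (v $ 6) (v $ 12) x y z > 0"
      by blast
  next
    assume "\<forall>x y z. x \<noteq> 0 \<or> y \<noteq> 0 \<or> z \<noteq> 0 \<longrightarrow>
      hankel_sextic (v $ 0) (v $ 6) (v $ 12) x y z > 0"
    then show "tensor_pd (hankel_tensor v)"
      unfolding tensor_pd_def nz tensor_form_truncated_hankel[OF assms] by blast
  qed
qed

theorem theorem2:
  fixes v :: "real ^ 13" and A :: tensor
  assumes "truncated v" and "A = hankel_tensor v"
  shows "(tensor_psd A \<longleftrightarrow> tensor_sos A) \<and>
         (tensor_sos A \<longleftrightarrow>
            v $ 0 \<ge> 0 \<and> v $ 6 \<ge> 0 \<and> v $ 12 \<ge> 0 \<and>
            sqrt (v $ 0 * v $ 12) \<ge> (560 + 70 * sqrt 70) * v $ 6) \<and>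
         (tensor_pd A \<longleftrightarrow>
            v $ 0 > 0 \<and> v $ 6 > 0 \<and> v $ 12 > 0 \<and>
            sqrt (v $ 0 * v $ 12) > (560 + 70 * sqrt 70) * v $ 6)"
proof -
  let ?f = "hankel_sextic (v $ 0) (v $ 6) (v $ 12)"
  let ?P = "v $ 0 \<ge> 0 \<and> v $ 6 \<ge> 0 \<and> v $ 12 \<ge> 0 \<and> sqrt (v $ 0 * v $ 12) \<ge> critical * v $ 6"
  let ?Q = "v $ 0 > 0 \<and> v $ 6 > 0 \<and> v $ 12 > 0 \<and> sqrt (v $ 0 * v $ 12) > critical * v $ 6"
  note psd_iff = truncated_hankel_psd_iff[OF assms(1), folded assms(2)]
  note pd_iff = truncated_hankel_pd_iff[OF assms(1), folded assms(2)]
  have axes: "?f 1 0 0 = v $ 0" "?f 0 1 0 = v $ 6" "?f 0 0 1 = v $ 12"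
    by (simp_all add: hankel_sextic_def)
  have "tensor_psd A" if "tensor_sos A"
    using that by (auto simp: tensor_sos_def tensor_psd_def sum_nonneg)
  moreover have "?P" if "tensor_psd A"
  proof -
    have nonneg: "?f x y z \<ge> 0" for x y z
      using that psd_iff by blast
    have "v $ 0 \<ge> 0" "v $ 6 \<ge> 0" "v $ 12 \<ge> 0"
      using nonneg[of 1 0 0] nonneg[of 0 1 0] nonneg[of 0 0 1] by (simp_all add: axes)
    then show ?thesis
      using sqrt_ge_critical_if_hankel_sextic_nonneg nonneg by blast
  qed
  moreover have "tensor_sos A" if "?P"
    using that tensor_sos_if_sqrt_ge_critical assms by blast
  moreover have "?Q" if "tensor_pd A"
  proof -
    have pos: "?f x y z > 0" if "x \<noteq> 0 \<or> y \<noteq> 0 \<or> z \<noteq> 0" for x y z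
      using that \<open>tensor_pd A\<close> pd_iff by blast
    have v: "v $ 0 > 0" "v $ 6 > 0" "v $ 12 > 0"
      using pos[of 1 0 0] pos[of 0 1 0] pos[of 0 0 1] by (simp_all add: axes)
    obtain x y z where "x \<noteq> 0" "?f x y z = 2 * (sqrt (v $ 0 * v $ 12) - critical * v $ 6)"
      using hankel_sextic_critical_value[OF v(1,3)] by metis
    then show ?thesis
      using pos[of x y z] v by simp
  qed
  moreover have "tensor_pd A" if "?Q"
    using that hankel_sextic_pos pd_iff by blast
  ultimately show ?thesis
    unfolding critical_def by blast
qed

end
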